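(* Let $\mathbb{F}$ be an algebraically closed field of characteristic zero and let $\mathcal{A}$ be a two-dimensional $\mathbb{F}$-algebra. 1. If the group $\mathrm{Aut}(\mathcal{A})$ is infinite, then $\mathcal{A}$ does not admit a symmetric invariant nondegenerate bilinear form. 2. If the algebra $\mathcal{A}$ is simple, then $\mathcal{A}$ admits a symmetric invariant nondegenerate bilinear form.
   Context: An algebra is a vector space with a bilinear multiplication, not necessarily associative; it is simple if its multiplication is not identically zero and it has no two-sided ideals other than $0$ and itself. $\mathrm{Aut}(\mathcal{A})$ is the group of algebra automorphisms of $\mathcal{A}$. A bilinear form $\varphi:\mathcal{A}^2\to\mathbb{F}$ is invariant if $\varphi(g\cdot a,g\cdot b)=\varphi(a,b)$ for all $g\in\mathrm{Aut}(\mathcal{A})$ and $a,b\in\mathcal{A}$, and symmetric if $\varphi(a,b)=\varphi(b,a)$ for all $a,b\in\mathcal{A}$. *)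

theory Defs
  imports Complex_Main "HOL-Computational_Algebra.Polynomial"
begin

locale nonassoc_algebra = vector_space scale
  for scale :: "'f::field \<Rightarrow> 'a::ab_group_add \<Rightarrow> 'a" +
  fixes mult :: "'a \<Rightarrow> 'a \<Rightarrow> 'a"
  assumes linear_mult_left: "\<And>x. Vector_Spaces.linear scale scale (\<lambda>y. mult x y)"
    and linear_mult_right: "\<And>y. Vector_Spaces.linear scale scale (\<lambda>x. mult x y)"
begin

definition two_sided_ideal :: "'a set \<Rightarrow> bool" where
  "two_sided_ideal I \<longleftrightarrow>
     subspace I \<and> (\<forall>x. \<forall>y\<in>I. mult x y \<in> I \<and> mult y x \<in> I)"

definition simple_algebra :: bool where
  "simple_algebra \<longleftrightarrow>
     (\<exists>x y. mult x y \<noteq> 0) \<and> (\<forall>I. two_sided_ideal I \<longrightarrow> I = {0} \<or> I = UNIV)"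

text \<open>The underlying set of the automorphism group; the group operation is composition.\<close>

definition Aut :: "('a \<Rightarrow> 'a) set" where
  "Aut = {g. Vector_Spaces.linear scale scale g \<and> bij g \<and>
             (\<forall>x y. g (mult x y) = mult (g x) (g y))}"

definition bilinear_form :: "('a \<Rightarrow> 'a \<Rightarrow> 'f) \<Rightarrow> bool" where
  "bilinear_form \<phi> \<longleftrightarrow>
     (\<forall>a. Vector_Spaces.linear scale (*) (\<lambda>b. \<phi> a b)) \<and>
     (\<forall>b. Vector_Spaces.linear scale (*) (\<lambda>a. \<phi> a b))"

definition invariant_form :: "('a \<Rightarrow> 'a \<Rightarrow> 'f) \<Rightarrow> bool" where
  "invariant_form \<phi> \<longleftrightarrow> (\<forall>g\<in>Aut. \<forall>a b. \<phi> (g a) (g b) = \<phi> a b)"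

definition symmetric_form :: "('a \<Rightarrow> 'a \<Rightarrow> 'f) \<Rightarrow> bool" where
  "symmetric_form \<phi> \<longleftrightarrow> (\<forall>a b. \<phi> a b = \<phi> b a)"

definition nondegenerate_form :: "('a \<Rightarrow> 'a \<Rightarrow> 'f) \<Rightarrow> bool" where
  "nondegenerate_form \<phi> \<longleftrightarrow>
     (\<forall>a. (\<forall>b. \<phi> a b = 0) \<longrightarrow> a = 0) \<and> (\<forall>b. (\<forall>a. \<phi> a b = 0) \<longrightarrow> b = 0)"

definition admits_symmetric_invariant_nondegenerate_form :: bool where
  "admits_symmetric_invariant_nondegenerate_form \<longleftrightarrow>
     (\<exists>\<phi>. bilinear_form \<phi> \<and> symmetric_form \<phi> \<and> invariant_form \<phi> \<and> nondegenerate_form \<phi>)"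

lemma id_in_Aut: "id \<in> Aut"
  unfolding Aut_def by (simp add: linear_id)

lemma comp_in_Aut: "g \<in> Aut \<Longrightarrow> h \<in> Aut \<Longrightarrow> g \<circ> h \<in> Aut"
  unfolding Aut_def by (auto intro: Vector_Spaces.linear_compose bij_comp)

lemma inv_in_Aut:
  assumes "g \<in> Aut"
  shows "inv g \<in> Aut"
proof -
  have lin: "Vector_Spaces.linear scale scale g" and bij: "bij g"
    and hom: "\<And>x y. g (mult x y) = mult (g x) (g y)"
    using assms unfolding Aut_def by auto
  interpret g: Vector_Spaces.linear scale scale g by (fact lin)
  have gi: "g (inv g x) = x" for x
    using bij by (simp add: bij_is_surj surj_f_inv_f)
  have ig: "inv g y = x \<longleftrightarrow> y = g x" for x y
    using bij gi by (metis bij_inv_eq_iff)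
  have "Vector_Spaces.linear scale scale (inv g)"
    by unfold_locales (simp_all add: ig gi g.add g.scale)
  moreover have "inv g (mult x y) = mult (inv g x) (inv g y)" for x y
    by (simp add: ig gi hom)
  ultimately show ?thesis
    using bij unfolding Aut_def by (simp add: bij_imp_bij_inv)
qed

end

end

theory Submission
  imports Defs
begin

text \<open>
  \<^bold>\<open>Infinite automorphism group.\<close> Over an algebraically closed field a symmetric nondegenerate form
  \<open>\<phi>\<close> on a plane has a basis \<open>e, f\<close> of isotropic vectors with \<open>\<phi> e f = 1\<close>. An isometry either
  fixes both lines, acting as \<open>diag(t, 1/t)\<close>, or exchanges them. A product of two basis vectors
  is zero or an eigenvector of such an automorphism for the eigenvalue \<open>t\<^sup>2\<close>, \<open>1\<close> or \<open>1/t\<^sup>2\<close>, whereas the eigenvalues are \<open>t\<close> and \<open>1/t\<close>;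
  unless \<open>t\<^sup>3 = 1\<close> these never agree and all products vanish.
  But an algebra with zero multiplication has the homothety by \<open>2\<close> among its automorphisms, and this is not an isometry. Hence \<open>t\<^sup>3 = 1\<close> throughout, only finitely many automorphisms
  fix the two lines, and composition with one automorphism exchanging the lines shows that those are
  finitely many as well.

  \<^bold>\<open>Simple algebras.\<close> Put an automorphism \<open>g\<close> of a simple algebra in triangular form and compare the two
  sides of \<open>g (x y) = g x g y\<close> on basis vectors. If \<open>g\<close> is not diagonalizable, its eigenvectors span an
  ideal. If \<open>g = diag(a, b)\<close>, then \<open>g\<close> is the identity or a reflection \<open>diag(1, -1)\<close>, unless \<open>a\<close> and
  \<open>b\<close> are both different from \<open>1\<close>; in that case the multiplication is
  \<open>e e = \<beta> f\<close>, \<open>f f = \<alpha> e\<close>, \<open>e f = f e = 0\<close>. For this last algebra the form with isotropic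
  \<open>e, f\<close> and \<open>\<phi> e f = 1\<close> is invariant. For every other algebra all automorphisms are
  involutions, so they commute; two different reflections would be simultaneously diagonal with product \<open>-1\<close>,
  which is impossible since \<open>-1\<close> is not an automorphism of an algebra with a nonzero product. So there is at most
  one reflection, and the form with an orthonormal eigenbasis is invariant.
\<close>

section \<open>Algebras with a chosen basis\<close>

context nonassoc_algebra
begin

lemma mult_simps:
  "mult (x + y) z = mult x z + mult y z" "mult z (x + y) = mult z x + mult z y"
  "mult (scale c x) z = scale c (mult x z)" "mult z (scale c x) = scale c (mult z x)"
proof -
  interpret l: Vector_Spaces.linear scale scale "\<lambda>y. mult z y" by (rule linear_mult_left)
  interpret r: Vector_Spaces.linear scale scale "\<lambda>x. mult x z" by (rule linear_mult_right)
  show "mult (x + y) z = mult x z + mult y z" "mult z (x + y) = mult z x + mult z y"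
    "mult (scale c x) z = scale c (mult x z)" "mult z (scale c x) = scale c (mult z x)"
    by (rule r.add l.add r.scale l.scale)+
qed

lemma Aut_simps:
  assumes "g \<in> Aut"
  shows "g (x + y) = g x + g y" "g (scale c x) = scale c (g x)" "g (mult x y) = mult (g x) (g y)"
    "g x = g y \<longleftrightarrow> x = y" "g 0 = 0"
proof -
  interpret g: Vector_Spaces.linear scale scale g using assms by (simp add: Aut_def)
  show "g (x + y) = g x + g y" "g (scale c x) = scale c (g x)" "g 0 = 0"
    by (rule g.add g.scale g.zero)+
  show "g (mult x y) = mult (g x) (g y)" "g x = g y \<longleftrightarrow> x = y"
    using assms by (auto simp: Aut_def bij_def inj_eq)
qed

lemma zero_mult_imp_scale_mem_Aut:
  assumes "\<And>x y. mult x y = 0" and "c \<noteq> 0"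
  shows "scale c \<in> Aut"
proof -
  have "Vector_Spaces.linear scale scale (scale c)"
    by unfold_locales (simp_all add: scale_right_distrib mult.commute)
  moreover have "bij (scale c)"
    by (rule o_bij[of "scale (1 / c)"]) (use assms in \<open>auto simp: fun_eq_iff\<close>)
  ultimately show ?thesis
    using assms by (simp add: Aut_def)
qed

end

text \<open>
  A basis \<open>e, f\<close> together with its dual basis \<open>p, q\<close>. With the coordinate functionals
  at hand, identities between vectors become pairs of identities between scalars.
\<close>

locale framed_algebra = nonassoc_algebra scale mult
  for scale :: "'f::field_char_0 \<Rightarrow> 'a::ab_group_add \<Rightarrow> 'a" and mult +
  fixes e f :: 'a and p q :: "'a \<Rightarrow> 'f"
  assumes p_linear: "p (x + y) = p x + p y" "p (scale c x) = c * p x"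
    and q_linear: "q (x + y) = q x + q y" "q (scale c x) = c * q x"
    and dual: "p e = 1" "p f = 0" "q e = 0" "q f = 1"
    and expansion: "x = scale (p x) e + scale (q x) f"
begin

lemma p_zero: "p 0 = 0" and q_zero: "q 0 = 0"
  using p_linear(2)[of 0 0] q_linear(2)[of 0 0] by simp_all

lemma p_minus: "p (- x) = - p x" and q_minus: "q (- x) = - q x"
  using p_linear(1)[of x "- x"] q_linear(1)[of x "- x"] by (simp_all add: p_zero q_zero eq_neg_iff_add_eq_0 add.commute)

lemma p_diff: "p (x - y) = p x - p y" and q_diff: "q (x - y) = q x - q y"
  using p_linear(1)[of "x - y" y] q_linear(1)[of "x - y" y] by simp_all

lemmas coords = p_linear q_linear dual p_zero q_zero p_minus q_minus p_diff q_diff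

lemma eq_iff_coords: "x = y \<longleftrightarrow> p x = p y \<and> q x = q y"
  using expansion[of x] expansion[of y] by metis

lemma basis_nonzero: "e \<noteq> 0" "f \<noteq> 0"
  by (simp_all add: eq_iff_coords coords)

lemma swap_frame: "framed_algebra scale mult f e q p"
  by unfold_locales (simp_all add: coords eq_iff_coords)

lemma mult_expansion:
  "mult x y = scale (p x * p y) (mult e e) + scale (p x * q y) (mult e f)
     + scale (q x * p y) (mult f e) + scale (q x * q y) (mult f f)"
  by (subst expansion[of x], subst expansion[of y])
     (simp add: mult_simps scale_right_distrib algebra_simps)

lemma mult_eq_zero:
  assumes "mult e e = 0" "mult e f = 0" "mult f e = 0" "mult f f = 0"
  shows "mult x y = 0"
  using mult_expansion[of x y] assms by simp

lemma Aut_expansion: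
  assumes "g \<in> Aut"
  shows "g x = scale (p x) (g e) + scale (q x) (g f)"
  by (subst expansion[of x]) (simp only: Aut_simps[OF assms])

lemma Aut_eqI:
  assumes "g \<in> Aut" "h \<in> Aut" "g e = h e" "g f = h f"
  shows "g = h"
proof
  fix x
  show "g x = h x"
    using Aut_expansion[OF assms(1), of x] Aut_expansion[OF assms(2), of x] assms(3,4) by simp
qed

lemma simple_imp_line_not_ideal:
  assumes simple: simple_algebra
    and "q (mult e e) = 0" "q (mult e f) = 0" "q (mult f e) = 0"
  shows False
proof -
  have "two_sided_ideal {x. q x = 0}"
    unfolding two_sided_ideal_def
  proof (intro conjI allI ballI)
    show "subspace {x. q x = 0}"
      by (simp add: subspace_def coords)
    fix x y assume "y \<in> {x. q x = 0}"
    then show "mult x y \<in> {x. q x = 0}" "mult y x \<in> {x. q x = 0}"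
      using assms by (subst mult_expansion, simp add: coords)+
  qed
  then have "{x. q x = 0} = {0} \<or> {x. q x = 0} = UNIV"
    using simple by (simp add: simple_algebra_def)
  moreover have "e \<in> {x. q x = 0}" "f \<notin> {x. q x = 0}"
    by (simp_all add: coords)
  ultimately show False
    using basis_nonzero by auto
qed

section \<open>Automorphisms in triangular form\<close>

text \<open>
  The eigenvector \<open>e\<close> would span an ideal. The eigenspace of \<open>g\<close> is the line of \<open>e\<close>, so \<open>e e\<close>, which is zero or an
  eigenvector, lies on it. If \<open>a \<noteq> 1\<close>, the same reasoning modulo this line applies to \<open>e f\<close> and \<open>f e\<close>. If \<open>a = 1\<close>,
  both products have the same \<open>f\<close>-coordinate, and comparing the \<open>f\<close>-coordinates in \<open>g (f f)\<close> shows that their sum is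
  zero.
\<close>

lemma simple_imp_no_shear:
  assumes simple: simple_algebra and g: "g \<in> Aut"
    and ge: "g e = scale a e" and gf: "g f = scale a f + scale c e" and c: "c \<noteq> 0"
  shows False
proof -
  have a: "a \<noteq> 0"
    using Aut_simps(4)[OF g, of e 0] Aut_simps(5)[OF g] basis_nonzero ge by auto
  note E = eq_iff_coords Aut_simps(1,2)[OF g] ge gf mult_simps coords scale_right_distrib
  have ee: "a * p (mult e e) + c * q (mult e e) = a * a * p (mult e e)"
      "a * q (mult e e) = a * a * q (mult e e)"
    using Aut_simps(3)[OF g, of e e] unfolding Aut_expansion[OF g, of "mult e e"]
    by (simp_all add: E algebra_simps)
  have ef: "a * p (mult e f) + c * q (mult e f) = a * a * p (mult e f) + a * c * p (mult e e)"
      "a * q (mult e f) = a * a * q (mult e f) + a * c * q (mult e e)"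
    using Aut_simps(3)[OF g, of e f] unfolding Aut_expansion[OF g, of "mult e f"]
    by (simp_all add: E algebra_simps)
  have fe: "a * p (mult f e) + c * q (mult f e) = a * a * p (mult f e) + a * c * p (mult e e)"
      "a * q (mult f e) = a * a * q (mult f e) + a * c * q (mult e e)"
    using Aut_simps(3)[OF g, of f e] unfolding Aut_expansion[OF g, of "mult f e"]
    by (simp_all add: E algebra_simps)
  have ff: "a * q (mult f f) = a * a * q (mult f f) + a * c * q (mult e f) + a * c * q (mult f e)
      + c * c * q (mult e e)"
    using Aut_simps(3)[OF g, of f f] unfolding Aut_expansion[OF g, of "mult f f"]
    by (simp_all add: E algebra_simps)
  have qee: "q (mult e e) = 0"
    using ee a c by (cases "a = 1") auto
  have "q (mult e f) = 0 \<and> q (mult f e) = 0"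
  proof (cases "a = 1")
    case True
    have eq: "q (mult e f) = p (mult e e)" "q (mult f e) = p (mult e e)"
      using ef(1) fe(1) c True by simp_all
    have "c * (2 * p (mult e e)) = 0"
      using ff qee True by (simp add: eq algebra_simps)
    then show ?thesis
      using c eq by simp
  next
    case False
    then show ?thesis
      using ef(2) fe(2) a qee by simp
  qed
  then show False
    using simple_imp_line_not_ideal simple qee by blast
qed

text \<open>
  If \<open>a = 1 \<noteq> b\<close>, the products \<open>e f\<close> and \<open>f e\<close> are multiples of \<open>f\<close>; since \<open>f\<close> does not span an ideal,
  \<open>f f\<close> has a component along \<open>e\<close>, which forces \<open>b\<^sup>2 = 1\<close>.
\<close>

lemma simple_imp_reflection:
  assumes simple: simple_algebra and g: "g \<in> Aut"
    and ge: "g e = e" and gf: "g f = scale b f" and b: "b \<noteq> 1"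
  shows "b = - 1"
proof -
  interpret swapped: framed_algebra scale mult f e q p by (rule swap_frame)
  note E = eq_iff_coords ge gf mult_simps coords scale_right_distrib
  have ef: "p (mult e f) = 0"
    using Aut_simps(3)[OF g, of e f] b unfolding Aut_expansion[OF g, of "mult e f"]
    by (auto simp add: E)
  have fe: "p (mult f e) = 0"
    using Aut_simps(3)[OF g, of f e] b unfolding Aut_expansion[OF g, of "mult f e"]
    by (auto simp add: E)
  have ff: "p (mult f f) = b * b * p (mult f f)"
    using Aut_simps(3)[OF g, of f f] b unfolding Aut_expansion[OF g, of "mult f f"]
    by (auto simp add: E)
  have "p (mult f f) \<noteq> 0"
    using swapped.simple_imp_line_not_ideal[OF simple] ef fe by blast
  then have "b * b = 1"
    using ff by simp
  then show ?thesis
    using b square_eq_1_iff by blast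
qed

text \<open>
  The product \<open>e f\<close> is scaled by \<open>a b\<close>, which is neither \<open>a\<close> nor \<open>b\<close>; the product \<open>e e\<close> is scaled by \<open>a\<^sup>2 \<noteq> a\<close>.
\<close>

lemma diagonal_without_eigenvalue_one:
  assumes g: "g \<in> Aut"
    and ge: "g e = scale a e" and gf: "g f = scale b f" and ab: "a \<noteq> 1" "b \<noteq> 1"
  shows "mult e f = 0" "mult f e = 0" "p (mult e e) = 0" "q (mult f f) = 0"
proof -
  have a: "a \<noteq> 0" "b \<noteq> 0"
    using Aut_simps(4)[OF g, of e 0] Aut_simps(4)[OF g, of f 0] Aut_simps(5)[OF g] basis_nonzero ge gf
    by auto
  note E = eq_iff_coords ge gf mult_simps coords scale_right_distrib
  show "mult e f = 0"
    using Aut_simps(3)[OF g, of e f] a ab unfolding Aut_expansion[OF g, of "mult e f"]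
    by (auto simp add: E)
  show "mult f e = 0"
    using Aut_simps(3)[OF g, of f e] a ab unfolding Aut_expansion[OF g, of "mult f e"]
    by (auto simp add: E)
  show "p (mult e e) = 0"
    using Aut_simps(3)[OF g, of e e] a ab unfolding Aut_expansion[OF g, of "mult e e"]
    by (auto simp add: E)
  show "q (mult f f) = 0"
    using Aut_simps(3)[OF g, of f f] a ab unfolding Aut_expansion[OF g, of "mult f f"]
    by (auto simp add: E)
qed

section \<open>Invariant forms from Gram matrices\<close>

definition gram_form :: "'f \<Rightarrow> 'f \<Rightarrow> 'f \<Rightarrow> 'a \<Rightarrow> 'a \<Rightarrow> 'f" where
  "gram_form a b c x y = a * p x * p y + b * (p x * q y + q x * p y) + c * q x * q y"

lemma admits_form_if_gram_preserved:
  assumes det: "a * c \<noteq> b * b"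
    and inv: "\<And>g. g \<in> Aut \<Longrightarrow> gram_form a b c (g e) (g e) = a \<and>
       gram_form a b c (g e) (g f) = b \<and> gram_form a b c (g f) (g f) = c"
  shows admits_symmetric_invariant_nondegenerate_form
proof -
  let ?G = "gram_form a b c"
  have comm: "?G x y = ?G y x" for x y
    by (simp add: gram_form_def algebra_simps)
  have lin: "?G x (y + z) = ?G x y + ?G x z" "?G x (scale k y) = k * ?G x y" for x y z k
    by (simp_all add: gram_form_def coords algebra_simps)
  have "Vector_Spaces.linear scale (*) (\<lambda>y. ?G x y)" for x
    by unfold_locales (simp_all add: lin algebra_simps)
  then have "bilinear_form ?G"
    unfolding bilinear_form_def using comm by (simp add: comm[of _ x for x])
  moreover have "symmetric_form ?G"
    unfolding symmetric_form_def using comm by blast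
  moreover have "invariant_form ?G"
    unfolding invariant_form_def
  proof (intro ballI allI)
    fix g x y assume g: "g \<in> Aut"
    have lin': "?G (y + z) x = ?G y x + ?G z x" "?G (scale k y) x = k * ?G y x" for x y z k
      using lin comm by metis+
    have "?G (g x) (g y) = ?G (scale (p x) (g e) + scale (q x) (g f)) (scale (p y) (g e) + scale (q y) (g f))"
      using Aut_expansion[OF g, of x] Aut_expansion[OF g, of y] by simp
    also have "\<dots> = ?G x y"
      using inv[OF g] comm[of "g f" "g e"]
      by (simp add: lin lin') (simp add: gram_form_def algebra_simps)
    finally show "?G (g x) (g y) = ?G x y" .
  qed
  moreover have nondeg: "x = 0" if "\<And>y. ?G x y = 0" for x
  proof -
    have 1: "a * p x + b * q x = 0" "b * p x + c * q x = 0"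
      using that[of e] that[of f] by (simp_all add: gram_form_def coords)
    have "(a * c - b * b) * p x = c * (a * p x + b * q x) - b * (b * p x + c * q x)"
      "(a * c - b * b) * q x = a * (b * p x + c * q x) - b * (a * p x + b * q x)"
      by (simp_all add: algebra_simps)
    then have "(a * c - b * b) * p x = 0" "(a * c - b * b) * q x = 0"
      unfolding 1 by simp_all
    with det show "x = 0"
      by (simp add: eq_iff_coords coords)
  qed
  then have "nondegenerate_form ?G"
    unfolding nondegenerate_form_def using comm by metis
  ultimately show ?thesis
    unfolding admits_symmetric_invariant_nondegenerate_form_def by blast
qed

text \<open>
  The algebra \<open>e e = \<beta> f\<close>, \<open>f f = \<alpha> e\<close>, \<open>e f = f e = 0\<close>: an automorphism is \<open>diag(x, x\<^sup>2)\<close> with \<open>x\<^sup>3 = 1\<close> or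
  exchanges the two lines by \<open>e \<mapsto> y f\<close>, \<open>f \<mapsto> (\<alpha>/\<beta>) y\<^sup>2 e\<close> with \<open>y\<^sup>3 = \<beta>/\<alpha>\<close>. Either way the product
  of the two matrix entries is \<open>1\<close>, so the hyperbolic form is invariant.
\<close>

lemma cyclic_algebra_admits_form:
  assumes simple: simple_algebra
    and prods: "mult e f = 0" "mult f e = 0" "p (mult e e) = 0" "q (mult f f) = 0"
  shows admits_symmetric_invariant_nondegenerate_form
proof (rule admits_form_if_gram_preserved)
  interpret swapped: framed_algebra scale mult f e q p by (rule swap_frame)
  show "0 * 0 \<noteq> (1 :: 'f) * 1" by simp
  fix g assume g: "g \<in> Aut"
  define \<alpha> \<beta> where "\<alpha> = p (mult f f)" and "\<beta> = q (mult e e)"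
  have \<beta>: "\<beta> \<noteq> 0"
    using simple_imp_line_not_ideal[OF simple] prods by (auto simp: \<beta>_def coords)
  have \<alpha>: "\<alpha> \<noteq> 0"
    using swapped.simple_imp_line_not_ideal[OF simple] prods by (auto simp: \<alpha>_def coords)
  have ee: "mult e e = scale \<beta> f" and ff: "mult f f = scale \<alpha> e"
    using prods by (simp_all add: eq_iff_coords coords \<alpha>_def \<beta>_def)
  define x y z w where "x = p (g e)" and "y = q (g e)" and "z = p (g f)" and "w = q (g f)"
  note xyzw = x_def y_def z_def w_def
  have m: "mult u v = scale (p u * p v * \<beta>) f + scale (q u * q v * \<alpha>) e" for u v
    by (subst mult_expansion) (simp add: prods ee ff)
  have g_ee: "scale \<beta> (g f) = mult (g e) (g e)" and g_ff: "scale \<alpha> (g e) = mult (g f) (g f)"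
    using Aut_simps(2,3)[OF g] ee ff by metis+
  have g_ef: "0 = mult (g e) (g f)"
    using Aut_simps(3,5)[OF g] prods(1) by metis
  have 1: "\<beta> * z = y * y * \<alpha>" "w = x * x"
    using g_ee \<beta> unfolding m eq_iff_coords by (auto simp: coords xyzw)
  have 2: "x * z = 0" "y * w = 0"
    using g_ef \<alpha> \<beta> unfolding m eq_iff_coords by (auto simp: coords xyzw)
  have 3: "x = w * w" "\<alpha> * y = z * z * \<beta>"
    using g_ff \<alpha> unfolding m eq_iff_coords by (auto simp: coords xyzw)
  have ne: "x \<noteq> 0 \<or> y \<noteq> 0"
    using Aut_simps(4)[OF g, of e 0] basis_nonzero
    by (simp add: Aut_simps(5)[OF g] eq_iff_coords[of "g e"] coords xyzw)
  have "x * w + y * z = 1 \<and> x * y = 0 \<and> z * w = 0"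
  proof (cases "x = 0")
    case True
    then have y: "y \<noteq> 0" "w = 0"
      using ne 1 by auto
    have "\<alpha> * y * \<beta> = (z * \<beta>) * (z * \<beta>)"
      using 3 by simp
    also have "\<dots> = \<alpha> * y * (y * (\<beta> * z))"
      using 1 by (simp add: algebra_simps)
    finally have "\<beta> = \<beta> * (y * z)"
      using y \<alpha> by (simp add: algebra_simps)
    then show ?thesis
      using \<beta> True y by simp
  next
    case False
    then have "z = 0" "y = 0"
      using 2 1 \<alpha> by auto
    moreover have "x * (x * w) = x"
      using 3 1 by (simp add: algebra_simps)
    ultimately show ?thesis
      using False by simp
  qed
  then show "gram_form 0 1 0 (g e) (g e) = 0 \<and> gram_form 0 1 0 (g e) (g f) = 1 \<and>
      gram_form 0 1 0 (g f) (g f) = 0"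
    by (simp add: gram_form_def xyzw algebra_simps)
qed

text \<open>
  An involution commuting with \<open>diag(1, -1)\<close> is diagonal with entries \<open>\<plusminus>1\<close>. Neither it nor
  its product with \<open>diag(1, -1)\<close> can be \<open>-1\<close>, because \<open>(-u) (-v) = u v\<close> differs from \<open>-(u v)\<close>; only two sign
  patterns survive.
\<close>

lemma commuting_involutions:
  assumes nz: "mult u v \<noteq> 0"
    and s: "s \<in> Aut" "s e = e" "s f = - f"
    and t: "t \<in> Aut" "t \<circ> t = id" "t \<circ> s = s \<circ> t"
  shows "t = id \<or> t = s"
proof -
  have no_neg: False if h: "h \<in> Aut" and "h e = - e" "h f = - f" for h
  proof -
    have neg: "h x = - x" for x
      using Aut_expansion[OF h, of x] expansion[of x] that by (simp add: eq_iff_coords coords)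
    have "- mult u v = mult (- u) (- v)"
      using Aut_simps(3)[OF h, of u v] by (simp add: neg)
    also have "\<dots> = mult u v"
      using mult_simps(3)[of "- 1" u "- v"] mult_simps(4)[of u "- 1" v] by simp
    finally have "p (mult u v) = 0 \<and> q (mult u v) = 0"
      by (simp add: eq_iff_coords coords)
    then show False
      using nz by (simp add: eq_iff_coords coords)
  qed
  have neg: "g (- x) = - g x" if "g \<in> Aut" for g x
    using Aut_simps(2)[OF that, of "- 1" x] by simp
  define a b where "a = p (t e)" and "b = q (t f)"
  have "s (t e) = t e" "s (t f) = - t f"
    using fun_cong[OF t(3), of e] fun_cong[OF t(3), of f] by (simp_all add: s neg[OF t(1)])
  then have "q (t e) = 0" "p (t f) = 0"
    unfolding Aut_expansion[OF s(1), of "t e"] Aut_expansion[OF s(1), of "t f"]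
    by (simp_all add: eq_iff_coords s coords)
  then have te: "t e = scale a e" and tf: "t f = scale b f"
    by (simp_all add: eq_iff_coords coords a_def b_def)
  have "scale (a * a) e = e" "scale (b * b) f = f"
    using fun_cong[OF t(2), of e] fun_cong[OF t(2), of f] te tf
    by (simp_all add: Aut_simps(2)[OF t(1)])
  then have "a * a = 1" "b * b = 1"
    by (simp_all add: eq_iff_coords coords)
  then have "a = 1 \<or> a = - 1" "b = 1 \<or> b = - 1"
    by (simp_all add: square_eq_1_iff)
  then consider "a = 1" "b = 1" | "a = 1" "b = - 1" | "a = - 1" "b = 1" | "a = - 1" "b = - 1"
    by blast
  then show ?thesis
  proof cases
    case 1
    then show ?thesis
      using Aut_eqI[OF t(1) id_in_Aut] te tf by simp
  next
    case 2
    then show ?thesis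
      using Aut_eqI[OF t(1) s(1)] te tf s by simp
  next
    case 3
    then show ?thesis
      using no_neg[OF comp_in_Aut[OF s(1) t(1)]] te tf s by (simp add: neg[OF s(1)])
  next
    case 4
    then show ?thesis
      using no_neg[OF t(1)] te tf by simp
  qed
qed

end

section \<open>Bases adapted to a vector, an automorphism or a form\<close>

locale plane_algebra = nonassoc_algebra scale mult
  for scale :: "'f::{alg_closed_field, field_char_0} \<Rightarrow> 'a::ab_group_add \<Rightarrow> 'a" and mult +
  assumes dim_2: "dim (UNIV :: 'a set) = 2"
begin

lemma frame_of_basis:
  assumes B: "independent {e, f}" "span {e, f} = UNIV" "e \<noteq> f"
  obtains p q where "framed_algebra scale mult e f p q"
proof
  let ?r = "representation {e, f}"
  show "framed_algebra scale mult e f (\<lambda>x. ?r x e) (\<lambda>x. ?r x f)"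
  proof unfold_locales
    fix x y c
    show "?r (x + y) e = ?r x e + ?r y e" "?r (x + y) f = ?r x f + ?r y f"
      "?r (scale c x) e = c * ?r x e" "?r (scale c x) f = c * ?r x f"
      using B by (simp_all add: representation_add representation_scale)
    show "?r e e = 1" "?r e f = 0" "?r f e = 0" "?r f f = 1"
      using B by (simp_all add: representation_basis)
    have "(\<Sum>b\<in>{e, f}. scale (?r x b) b) = x"
      using B by (intro sum_representation_eq) auto
    then show "x = scale (?r x e) e + scale (?r x f) f"
      using B by simp
  qed
qed

lemma frame_of_independent:
  assumes "e \<noteq> 0" and f: "\<And>k. f \<noteq> scale k e"
  obtains p q where "framed_algebra scale mult e f p q"
proof -
  have ef: "independent {f, e}" "f \<noteq> e"
    using f[of 1] f assms by (auto simp: independent_insert span_singleton)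
  obtain B where B: "{f, e} \<subseteq> B" "independent B" "UNIV \<subseteq> span B"
    using maximal_independent_subset_extend[OF subset_UNIV ef(1)] by metis
  have card: "card B = 2"
    using basis_card_eq_dim[OF _ B(3,2)] dim_2 by simp
  then have "finite B"
    using card.infinite by fastforce
  then have "{f, e} = B"
    using B(1) card ef(2) by (intro card_subset_eq) auto
  then show thesis
    using frame_of_basis[of e f] that B ef by (metis insert_commute top.extremum_uniqueI)
qed

lemma frame_extending:
  assumes "e \<noteq> 0"
  obtains f p q where "framed_algebra scale mult e f p q"
proof -
  have "\<exists>f. \<forall>k. f \<noteq> scale k e"
  proof (rule ccontr)
    assume "\<not> ?thesis"
    then have "UNIV \<subseteq> span {e}"
      unfolding span_singleton by blast
    then have "card {e} = dim (UNIV :: 'a set)"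
      using assms by (intro basis_card_eq_dim) auto
    then show False
      by (simp add: dim_2)
  qed
  then show thesis
    using frame_of_independent[OF assms] that by metis
qed

lemma some_frame:
  obtains e f p q where "framed_algebra scale mult e f p q"
proof -
  have "\<exists>e. e \<noteq> (0 :: 'a)"
  proof (rule ccontr)
    assume "\<not> ?thesis"
    then have "(UNIV :: 'a set) \<subseteq> span {}"
      by auto
    then have "card ({} :: 'a set) = dim (UNIV :: 'a set)"
      by (intro basis_card_eq_dim independent_empty) auto
    then show False
      by (simp add: dim_2)
  qed
  then show thesis
    using frame_extending that by metis
qed

lemma quadratic_root:
  fixes b c :: 'f
  obtains x where "x * x + b * x + c = 0"
  using alg_closed_imp_poly_has_root[of "[:c, b, 1:]"] by (auto simp: algebra_simps)

text \<open>
  With \<open>l\<close> a root of the characteristic polynomial of the matrix of \<open>g\<close>, the eigenvector in the second case is the first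
  column of the adjugate of \<open>l - g\<close>.
\<close>

lemma Aut_eigenvector:
  assumes g: "g \<in> Aut"
  obtains a e where "e \<noteq> 0" "g e = scale a e"
proof -
  obtain u v p q where "framed_algebra scale mult u v p q"
    by (rule some_frame)
  then interpret framed_algebra scale mult u v p q .
  show thesis
  proof (cases "q (g u) = 0")
    case True
    then show thesis
      using that[of u "p (g u)"] basis_nonzero by (simp add: eq_iff_coords coords)
  next
    case False
    define a b c d where "a = p (g u)" and "b = q (g u)" and "c = p (g v)" and "d = q (g v)"
    obtain l where l: "l * l + (- (a + d)) * l + (a * d - b * c) = 0"
      by (rule quadratic_root)
    define m where "m = l - d"
    define w where "w = scale m u + scale b v"
    have "l * m = m * a + b * c" "l * b = m * b + b * d"
      using l by (simp_all add: m_def algebra_simps)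
    then have "g w = scale l w"
      by (simp add: w_def Aut_simps[OF g] eq_iff_coords coords a_def b_def c_def d_def)
    moreover have "w \<noteq> 0"
      using False by (simp add: w_def eq_iff_coords coords b_def)
    ultimately show thesis
      using that by blast
  qed
qed

text \<open>For distinct eigenvalues \<open>a\<close>, \<open>b\<close> the off-diagonal entry is removed by a shear of the basis.\<close>

lemma Aut_normal_form:
  assumes g: "g \<in> Aut"
  obtains (diagonal) e f p q a b where "framed_algebra scale mult e f p q"
      "g e = scale a e" "g f = scale b f"
  | (shear) e f p q a c where "framed_algebra scale mult e f p q"
      "g e = scale a e" "g f = scale a f + scale c e" "c \<noteq> 0"
proof -
  obtain a e where e: "e \<noteq> 0" "g e = scale a e"
    using Aut_eigenvector[OF g] .
  obtain f p q where fr: "framed_algebra scale mult e f p q"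
    using frame_extending[OF e(1)] .
  interpret framed_algebra scale mult e f p q by (rule fr)
  define b c where "b = q (g f)" and "c = p (g f)"
  have gf: "g f = scale b f + scale c e"
    by (simp add: eq_iff_coords coords b_def c_def)
  show thesis
  proof (cases "a = b")
    case True
    then show thesis
      using diagonal[OF fr e(2), of b] shear[OF fr e(2), of c] gf by (cases "c = 0") auto
  next
    case False
    define f' where "f' = f + scale (c / (b - a)) e"
    have "f' \<noteq> scale k e" for k
      by (simp add: f'_def eq_iff_coords coords)
    then obtain p' q' where fr': "framed_algebra scale mult e f' p' q'"
      using frame_of_independent[OF e(1)] by metis
    have "c + c / (b - a) * a = b * (c / (b - a))"
      using False by (simp add: field_simps)
    then have "g f' = scale b f'"
      by (simp add: f'_def Aut_simps[OF g] e gf eq_iff_coords coords algebra_simps)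
    then show thesis
      using diagonal[OF fr' e(2)] by blast
  qed
qed

text \<open>
  Nondegeneracy gives an isotropic vector \<open>e\<close> a partner \<open>w\<close> with \<open>\<phi> e w = 1\<close>, and adding a multiple of \<open>e\<close> to \<open>w\<close>
  makes \<open>w\<close> isotropic as well.
\<close>

lemma isotropic_frame:
  assumes "bilinear_form \<phi>" "symmetric_form \<phi>" "nondegenerate_form \<phi>"
  obtains e f p q where "framed_algebra scale mult e f p q" "\<And>x y. \<phi> x y = p x * q y + q x * p y"
proof -
  have comm: "\<phi> x y = \<phi> y x" for x y
    using assms by (simp add: symmetric_form_def)
  have lin: "\<phi> x (y + z) = \<phi> x y + \<phi> x z" "\<phi> x (scale k y) = k * \<phi> x y"
    "\<phi> x 0 = 0" for x y z k
  proof -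
    interpret l: Vector_Spaces.linear scale "(*)" "\<lambda>y. \<phi> x y"
      using assms by (simp add: bilinear_form_def)
    show "\<phi> x (y + z) = \<phi> x y + \<phi> x z" "\<phi> x (scale k y) = k * \<phi> x y" "\<phi> x 0 = 0"
      by (rule l.add l.scale l.zero)+
  qed
  have lin': "\<phi> (y + z) x = \<phi> y x + \<phi> z x" "\<phi> (scale k y) x = k * \<phi> y x" for x y z k
    using lin comm by metis+
  obtain u v p q where "framed_algebra scale mult u v p q"
    by (rule some_frame)
  then interpret uv: framed_algebra scale mult u v p q .
  \<comment> \<open>An isotropic vector: either \<open>u\<close>, or a root of the quadratic polynomial \<open>\<phi> (v + t u) (v + t u)\<close> in \<open>t\<close>.\<close>
  obtain e where e: "e \<noteq> 0" "\<phi> e e = 0"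
  proof (cases "\<phi> u u = 0")
    case True
    then show thesis
      using that uv.basis_nonzero by blast
  next
    case False
    obtain t where t: "t * t + (2 * \<phi> u v / \<phi> u u) * t + \<phi> v v / \<phi> u u = 0"
      by (rule quadratic_root)
    define w where "w = v + scale t u"
    have "\<phi> w w = \<phi> u u * (t * t + (2 * \<phi> u v / \<phi> u u) * t + \<phi> v v / \<phi> u u)"
      using False by (simp add: w_def lin lin' comm[of v u] field_simps)
    moreover have "w \<noteq> 0"
      by (simp add: w_def uv.eq_iff_coords uv.coords)
    ultimately show thesis
      using that t by simp
  qed
  then obtain w where w: "\<phi> e w \<noteq> 0"
    using assms(3) by (auto simp: nondegenerate_form_def)
  define w' where "w' = scale (1 / \<phi> e w) w"
  define k where "k = - \<phi> w' w' / 2"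
  define f where "f = w' + scale k e"
  have w': "\<phi> e w' = 1"
    using w by (simp add: w'_def lin)
  have f: "\<phi> e f = 1" "\<phi> f f = 0"
    by (simp_all add: f_def lin lin' w' e comm[of w' e]) (simp add: k_def)
  have "f \<noteq> scale k e" for k
    using f(1) e(2) by (auto simp: lin)
  then obtain p q where fr: "framed_algebra scale mult e f p q"
    using frame_of_independent[OF e(1)] by metis
  interpret framed_algebra scale mult e f p q by (rule fr)
  have "\<phi> x y = p x * q y + q x * p y" for x y
    by (subst expansion[of x], subst expansion[of y])
       (simp add: lin lin' e f comm[of f e])
  then show thesis
    using that fr by blast
qed

section \<open>The two implications\<close>

lemma admits_form_imp_finite_Aut:
  assumes admits_symmetric_invariant_nondegenerate_form
  shows "finite Aut"
proof -
  obtain \<phi> where \<phi>: "bilinear_form \<phi>" "symmetric_form \<phi>" "nondegenerate_form \<phi>" "invariant_form \<phi>"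
    using assms by (auto simp: admits_symmetric_invariant_nondegenerate_form_def)
  obtain e f p q where "framed_algebra scale mult e f p q"
      and form: "\<And>x y. \<phi> x y = p x * q y + q x * p y"
    using isotropic_frame[OF \<phi>(1-3)] by metis
  then interpret framed_algebra scale mult e f p q by simp
  have inv: "\<phi> (g x) (g y) = \<phi> x y" if "g \<in> Aut" for g x y
    using \<phi>(4) that by (simp add: invariant_form_def)
  have isometry: "p (g e) * q (g e) = 0" "p (g f) * q (g f) = 0"
      "p (g e) * q (g f) + q (g e) * p (g f) = 1" if g: "g \<in> Aut" for g
    using inv[OF g, of e e] inv[OF g, of f f] inv[OF g, of e f] by (auto simp: form coords)
  \<comment> \<open>Otherwise the homothety by \<open>2\<close> is an automorphism; it multiplies \<open>\<phi>\<close> by \<open>4\<close>.\<close>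
  have nonzero_mult: "\<exists>x y. mult x y \<noteq> 0"
  proof (rule ccontr)
    assume "\<not> ?thesis"
    then have "scale 2 \<in> Aut"
      by (intro zero_mult_imp_scale_mem_Aut) auto
    from isometry(3)[OF this] show False
      by (simp add: coords)
  qed
  let ?D = "{g \<in> Aut. q (g e) = 0}" and ?S = "{g \<in> Aut. p (g e) = 0}"
  have D: "g e = scale (p (g e)) e" "g f = scale (1 / p (g e)) f" "p (g e) ^ 3 = 1" if "g \<in> ?D" for g
  proof -
    have g: "g \<in> Aut" and qge: "q (g e) = 0"
      using that by simp_all
    define t u where "t = p (g e)" and "u = q (g f)"
    have tu: "t * u = 1"
      using isometry(3)[OF g] qge by (simp add: t_def u_def)
    then have nz: "t \<noteq> 0" "u \<noteq> 0"
      by auto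
    then have "p (g f) = 0"
      using isometry(2)[OF g] by (simp add: u_def)
    then have ge: "g e = scale t e" and gf: "g f = scale u f"
      using qge by (simp_all add: eq_iff_coords coords t_def u_def)
    have "u = 1 / t"
      using tu nz by (simp add: field_simps)
    with ge gf show "g e = scale (p (g e)) e" "g f = scale (1 / p (g e)) f"
      by (simp_all add: t_def)
    show "p (g e) ^ 3 = 1"
    proof (rule ccontr)
      assume "p (g e) ^ 3 \<noteq> 1"
      then have t3: "t * t * t \<noteq> 1"
        by (simp add: t_def power3_eq_cube)
      then have ne: "t \<noteq> 1" "u \<noteq> 1" "u \<noteq> t * t" "t \<noteq> u * u"
        using tu by (auto simp: mult.assoc)
      note E = eq_iff_coords ge gf mult_simps coords
      note diag = diagonal_without_eigenvalue_one[OF g ge gf ne(1,2)]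
      have "q (mult e e) = 0"
        using Aut_simps(3)[OF g, of e e] nz ne unfolding Aut_expansion[OF g, of "mult e e"]
        by (auto simp add: E)
      moreover have "p (mult f f) = 0"
        using Aut_simps(3)[OF g, of f f] nz ne unfolding Aut_expansion[OF g, of "mult f f"]
        by (auto simp add: E)
      ultimately have "mult e e = 0" "mult f f = 0"
        using diag by (simp_all add: eq_iff_coords coords)
      then show False
        using mult_eq_zero diag nonzero_mult by blast
    qed
  qed
  have "finite {t :: 'f. t ^ 3 = 1}"
    using poly_roots_finite[of "[:- 1, 0, 0, 1:] :: 'f poly"]
    by (simp add: power3_eq_cube algebra_simps)
  moreover have "inj_on (\<lambda>g. p (g e)) ?D"
  proof (rule inj_onI)
    fix g h assume gh: "g \<in> ?D" "h \<in> ?D" "p (g e) = p (h e)"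
    then have "g e = h e" "g f = h f"
      using D(1,2)[OF gh(1)] D(1,2)[OF gh(2)] by simp_all
    with gh show "g = h"
      by (intro Aut_eqI) simp_all
  qed
  moreover have "(\<lambda>g. p (g e)) ` ?D \<subseteq> {t. t ^ 3 = 1}"
    using D(3) by auto
  ultimately have finD: "finite ?D"
    by (meson inj_on_finite)
  \<comment> \<open>Composing with one automorphism \<open>s\<close> that exchanges the lines embeds \<open>?S\<close> into \<open>?D\<close>.\<close>
  have finS: "finite ?S"
  proof (cases "?S = {}")
    case True
    then show ?thesis
      by (simp only: finite.emptyI)
  next
    case False
    then obtain s where s: "s \<in> Aut" "p (s e) = 0"
      by blast
    have "inj_on (\<lambda>g. s \<circ> g) ?S"
      by (auto simp: inj_on_def fun_eq_iff Aut_simps(4)[OF s(1)])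
    moreover have "(\<lambda>g. s \<circ> g) ` ?S \<subseteq> ?D"
    proof clarify
      fix g assume g: "g \<in> Aut" "p (g e) = 0"
      have "p (s f) \<noteq> 0"
        using isometry(3)[OF s(1)] s(2) by auto
      then have "q (s f) = 0"
        using isometry(2)[OF s(1)] by simp
      then have "q (s (g e)) = 0"
        using Aut_expansion[OF s(1), of "g e"] g(2) by (simp add: coords)
      then show "s \<circ> g \<in> Aut \<and> q ((s \<circ> g) e) = 0"
        using comp_in_Aut s(1) g(1) by simp
    qed
    ultimately show ?thesis
      using finD by (rule inj_on_finite)
  qed
  have "finite (?D \<union> ?S)"
    using finD finS by (rule finite_UnI)
  moreover have "Aut \<subseteq> ?D \<union> ?S"
    using isometry(1) by auto
  ultimately show ?thesis
    by (rule finite_subset[rotated])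
qed

lemma simple_Aut_cases:
  assumes simple: simple_algebra and g: "g \<in> Aut"
  obtains (identity) "g = id"
  | (reflection) e f p q where "framed_algebra scale mult e f p q" "g e = e" "g f = - f"
  | (cyclic) e f p q where "framed_algebra scale mult e f p q"
      "mult e f = 0" "mult f e = 0" "p (mult e e) = 0" "q (mult f f) = 0"
  using g
proof (cases rule: Aut_normal_form)
  case (diagonal e f p q a b)
  interpret framed_algebra scale mult e f p q by (rule diagonal(1))
  interpret swapped: framed_algebra scale mult f e q p by (rule swap_frame)
  consider "a = 1" "b = 1" | "a = 1" "b \<noteq> 1" | "a \<noteq> 1" "b = 1" | "a \<noteq> 1" "b \<noteq> 1"
    by blast
  then show thesis
  proof cases
    case 1
    then show thesis
      using identity Aut_eqI[OF g id_in_Aut] diagonal by simp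
  next
    case 2
    then have "b = - 1"
      using simple_imp_reflection[OF simple g] diagonal by simp
    then show thesis
      using reflection[OF diagonal(1)] 2 diagonal by simp
  next
    case 3
    then have "a = - 1"
      using swapped.simple_imp_reflection[OF simple g] diagonal by simp
    then show thesis
      using reflection[OF swap_frame] 3 diagonal by simp
  next
    case 4
    then show thesis
      using cyclic[OF diagonal(1)] diagonal_without_eigenvalue_one[OF g diagonal(2,3)] by simp
  qed
next
  case (shear e f p q a c)
  interpret framed_algebra scale mult e f p q by (rule shear(1))
  show thesis
    using simple_imp_no_shear[OF simple g shear(2,3,4)] by simp
qed

lemma simple_imp_admits_form:
  assumes simple: simple_algebra
  shows admits_symmetric_invariant_nondegenerate_form
proof (cases "\<exists>e f p q. framed_algebra scale mult e f p q \<and>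
    mult e f = 0 \<and> mult f e = 0 \<and> p (mult e e) = 0 \<and> q (mult f f) = 0")
  case True
  then obtain e f p q where fr: "framed_algebra scale mult e f p q"
    and prods: "mult e f = 0" "mult f e = 0" "p (mult e e) = 0" "q (mult f f) = 0"
    by blast
  show ?thesis
    by (rule framed_algebra.cyclic_algebra_admits_form[OF fr simple prods])
next
  case False
  have refl: "\<exists>e f p q. framed_algebra scale mult e f p q \<and> g e = e \<and> g f = - f"
    if g: "g \<in> Aut" "g \<noteq> id" for g
    using simple g(1)
  proof (cases rule: simple_Aut_cases)
    case identity
    then show ?thesis
      using g(2) by simp
  next
    case reflection
    then show ?thesis
      by blast
  next
    case cyclic
    then show ?thesis
      using False by blast
  qed
  have involution: "g \<circ> g = id" if g: "g \<in> Aut" for g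
  proof (cases "g = id")
    case ne: False
    obtain e f p q where fr: "framed_algebra scale mult e f p q" and ge: "g e = e" and gf: "g f = - f"
      using refl[OF g ne] by blast
    interpret framed_algebra scale mult e f p q by (rule fr)
    have "g (- f) = f"
      using Aut_simps(2)[OF g, of "- 1" f] gf by simp
    then show ?thesis
      using Aut_eqI[OF comp_in_Aut[OF g g] id_in_Aut] ge gf by simp
  qed simp
  show ?thesis
  proof (cases "Aut = {id}")
    case True
    obtain e f p q where "framed_algebra scale mult e f p q"
      by (rule some_frame)
    then interpret framed_algebra scale mult e f p q .
    show ?thesis
      by (rule admits_form_if_gram_preserved[of 1 1 0]) (simp_all add: True gram_form_def coords)
  next
    case ne: False
    then obtain s where s: "s \<in> Aut" "s \<noteq> id"
      using id_in_Aut by blast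
    obtain e f p q where fr: "framed_algebra scale mult e f p q" and se: "s e = e" and sf: "s f = - f"
      using refl[OF s] by blast
    interpret framed_algebra scale mult e f p q by (rule fr)
    obtain u v where uv: "mult u v \<noteq> 0"
      using simple by (auto simp: simple_algebra_def)
    have Aut: "t = id \<or> t = s" if t: "t \<in> Aut" for t
    proof (rule commuting_involutions[OF uv s(1) se sf t involution[OF t]])
      have inv: "g (g x) = x" if "g \<in> Aut" for g x
        using fun_cong[OF involution[OF that], of x] by simp
      have "t (s x) = s (t x)" for x
        using inv[OF comp_in_Aut[OF s(1) t], of "s x"] inv[OF s(1)] inv[OF t] by (metis comp_apply)
      then show "t \<circ> s = s \<circ> t"
        by auto
    qed
    show ?thesis
    proof (rule admits_form_if_gram_preserved[of 1 1 0])
      fix g assume "g \<in> Aut"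
      then show "gram_form 1 0 1 (g e) (g e) = 1 \<and> gram_form 1 0 1 (g e) (g f) = 0 \<and>
          gram_form 1 0 1 (g f) (g f) = 1"
        using Aut[of g] by (auto simp: gram_form_def coords se sf)
    qed simp
  qed
qed

end

theorem corollary8p2:
  fixes scale :: "'f::{alg_closed_field, field_char_0} \<Rightarrow> 'a::ab_group_add \<Rightarrow> 'a"
    and mult :: "'a \<Rightarrow> 'a \<Rightarrow> 'a"
  assumes "nonassoc_algebra scale mult"
    and "vector_space.dim scale (UNIV :: 'a set) = 2"
  shows "(infinite (nonassoc_algebra.Aut scale mult) \<longrightarrow>
            \<not> nonassoc_algebra.admits_symmetric_invariant_nondegenerate_form scale mult) \<and>
         (nonassoc_algebra.simple_algebra scale mult \<longrightarrow>
            nonassoc_algebra.admits_symmetric_invariant_nondegenerate_form scale mult)"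
proof -
  interpret plane_algebra scale mult
    using assms by (intro plane_algebra.intro plane_algebra_axioms.intro)
  show ?thesis
    using admits_form_imp_finite_Aut simple_imp_admits_form by blast
qed

end
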